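(* Let $A\in\mathbb R^{n\times n}$, $b\in\mathbb R^n$ with $(A,b)$ controllable, and let $C_1,C_2\in\mathbb R^{1\times n}$. Suppose that along every trajectory of the system $x'(t)=Ax(t)+bu(t)$, $x(0)=0$, the corresponding outputs satisfy $$C_2x(t)=\frac{d}{dt}\big(C_1x(t)\big).$$ Then any pair of exactly output trackable targets $(f_1,f_2)$ must satisfy the compatibility condition $f_2=f_1'$ in the sense of distributions on $(0,T)$. If $f_1\in H^1(0,T)$, then necessarily $f_2=f_1'$ in $L^2(0,T)$.
   Context: $T>0$ is fixed; controls are scalar functions $u\in L^2(0,T)$, and a trajectory is the solution $x$ of $x'=Ax+bu$, $x(0)=0$ for such a $u$. $(A,b)$ is controllable if $\operatorname{rank}[b,Ab,\ldots,A^{n-1}b]=n$. A pair of targets $(f_1,f_2)$, with $f_1,f_2\in L^2(0,T)$, is exactly output trackable if there exists $u\in L^2(0,T)$ whose trajectory satisfies $C_1x=f_1$ and $C_2x=f_2$ on $(0,T)$. *)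

theory Defs
  imports "HOL-Analysis.Analysis"
begin

section \<open>Linear control systems with scalar input\<close>

text \<open>The columns of \<open>[b, A b, \<dots>, A\<^sup>n\<^sup>-\<^sup>1 b]\<close> have to be indexed by a type with \<open>n\<close> elements,
  so they are listed in the order given by a bijection \<open>e\<close> from \<open>'n\<close> onto \<open>{0, \<dots>, n - 1}\<close>.
  The rank does not depend on \<open>e\<close>, see \<open>rank_kalman_matrix\<close>.\<close>

definition kalman_matrix :: "('n::finite \<Rightarrow> nat) \<Rightarrow> real^'n^'n \<Rightarrow> real^'n \<Rightarrow> real^'n^'n" where
  "kalman_matrix e A b = (\<chi> i j. (((\<lambda>v. A *v v) ^^ e j) b) $ i)"

definition controllable :: "real^'n^'n \<Rightarrow> real^'n::finite \<Rightarrow> bool" where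
  "controllable A b \<longleftrightarrow>
     (\<exists>e. bij_betw e UNIV {..<CARD('n)} \<and> rank (kalman_matrix e A b) = CARD('n))"

lemma rank_kalman_matrix:
  fixes A :: "real^'n^'n" and b :: "real^'n::finite"
  assumes "bij_betw e UNIV {..<CARD('n)}"
  shows "rank (kalman_matrix e A b) = dim ((\<lambda>k. ((\<lambda>v. A *v v) ^^ k) b) ` {..<CARD('n)})"
proof -
  have "columns (kalman_matrix e A b) = (\<lambda>k. ((\<lambda>v. A *v v) ^^ k) b) ` range e"
    by (auto simp: columns_def column_def kalman_matrix_def)
  then show ?thesis
    using assms by (simp add: column_rank_def bij_betw_def)
qed

definition sys_output :: "real^'n^1 \<Rightarrow> real^'n::finite \<Rightarrow> real" where
  "sys_output C v = (C *v v) $ 1"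

definition in_L2 :: "real \<Rightarrow> (real \<Rightarrow> real) \<Rightarrow> bool" where
  "in_L2 T f \<longleftrightarrow> f \<in> borel_measurable (lebesgue_on {0<..<T}) \<and>
     integrable (lebesgue_on {0<..<T}) (\<lambda>t. (f t)\<^sup>2)"

definition absolutely_cont_on :: "real set \<Rightarrow> (real \<Rightarrow> 'a::real_normed_vector) \<Rightarrow> bool" where
  "absolutely_cont_on S f \<longleftrightarrow>
     (\<forall>\<epsilon>>0. \<exists>\<delta>>0. \<forall>P. finite P \<and> (\<forall>(a, b)\<in>P. a \<le> b \<and> {a..b} \<subseteq> S) \<and>
        disjoint_family_on (\<lambda>(a, b). {a<..<b}) P \<and> (\<Sum>(a, b)\<in>P. b - a) < \<delta> \<longrightarrow>
        (\<Sum>(a, b)\<in>P. norm (f b - f a)) < \<epsilon>)"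

text \<open>As \<open>u\<close> is merely square integrable, solutions of \<open>x' = A x + b u\<close> are meant in the sense of
  Caratheodory.\<close>

definition is_trajectory ::
  "real \<Rightarrow> real^'n^'n \<Rightarrow> real^'n \<Rightarrow> (real \<Rightarrow> real) \<Rightarrow> (real \<Rightarrow> real^'n::finite) \<Rightarrow> bool" where
  "is_trajectory T A b u x \<longleftrightarrow> in_L2 T u \<and> absolutely_cont_on {0..T} x \<and> x 0 = 0 \<and>
     (AE t in lebesgue_on {0<..<T}.
        (x has_vector_derivative (A *v x t + u t *\<^sub>R b)) (at t))"

definition exactly_output_trackable ::
  "real \<Rightarrow> real^'n^'n \<Rightarrow> real^'n::finite \<Rightarrow> real^'n^1 \<Rightarrow> real^'n^1 \<Rightarrow>
   (real \<Rightarrow> real) \<Rightarrow> (real \<Rightarrow> real) \<Rightarrow> bool" where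
  "exactly_output_trackable T A b C1 C2 f1 f2 \<longleftrightarrow> in_L2 T f1 \<and> in_L2 T f2 \<and>
     (\<exists>u x. is_trajectory T A b u x \<and>
        (AE t in lebesgue_on {0<..<T}. sys_output C1 (x t) = f1 t) \<and>
        (AE t in lebesgue_on {0<..<T}. sys_output C2 (x t) = f2 t))"

section \<open>Distributions on \<open>(0, T)\<close>\<close>

text \<open>Test functions are extended by zero to the real line.\<close>

definition test_functions :: "real \<Rightarrow> (real \<Rightarrow> real) set" where
  "test_functions T = {\<phi>. (\<forall>k t. (deriv ^^ k) \<phi> field_differentiable (at t)) \<and>
     compact (closure {t. \<phi> t \<noteq> 0}) \<and> closure {t. \<phi> t \<noteq> 0} \<subseteq> {0<..<T}}"

definition distribution_of :: "real \<Rightarrow> (real \<Rightarrow> real) \<Rightarrow> (real \<Rightarrow> real) \<Rightarrow> real" where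
  "distribution_of T f \<phi> = integral\<^sup>L (lebesgue_on {0<..<T}) (\<lambda>t. f t * \<phi> t)"

definition distribution_deriv :: "((real \<Rightarrow> real) \<Rightarrow> real) \<Rightarrow> (real \<Rightarrow> real) \<Rightarrow> real" where
  "distribution_deriv \<Lambda> \<phi> = - \<Lambda> (deriv \<phi>)"

definition has_distributional_derivative ::
  "real \<Rightarrow> (real \<Rightarrow> real) \<Rightarrow> (real \<Rightarrow> real) \<Rightarrow> bool" where
  "has_distributional_derivative T f g \<longleftrightarrow>
     (\<forall>\<phi>\<in>test_functions T. distribution_of T g \<phi> = distribution_deriv (distribution_of T f) \<phi>)"

definition in_H1 :: "real \<Rightarrow> (real \<Rightarrow> real) \<Rightarrow> bool" where
  "in_H1 T f \<longleftrightarrow> in_L2 T f \<and> (\<exists>g. in_L2 T g \<and> has_distributional_derivative T f g)"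

end

theory Submission
  imports Defs
begin

text \<open>Fix a trajectory \<open>x\<close> that realises the targets, and put \<open>y = C\<^sub>1 x\<close>, \<open>z = C\<^sub>2 x\<close>. The
  hypothesis says that \<open>y' = z\<close> almost everywhere, which by itself would not determine \<open>y\<close> (think of
  the Cantor function). But \<open>y\<close> is absolutely continuous, because \<open>x\<close> is, and therefore it is an
  integral of \<open>z\<close> (\<open>fundamental_theorem_of_calculus_absolutely_cont\<close>). Since \<open>z\<close> is continuous,
  \<open>y\<close> is of class \<open>C\<^sup>1\<close> with \<open>y' = z\<close> everywhere (\<open>has_vector_derivative_if_AE\<close>), and integration
  by parts against a test function gives \<open>y' = z\<close> as distributions. The targets agree with \<open>y\<close> and
  \<open>z\<close> up to null sets, which distributions do not see.

  The second claim is the uniqueness of a square integrable distributional derivative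
  (\<open>distributional_derivative_unique\<close>), that is, the fundamental lemma of the calculus of
  variations. It needs enough test functions: rescaled products of \<open>exp (- 1 / t)\<close>, continued by zero to \<open>t \<le> 0\<close>, are smooth and
  increase to the indicator function of any open subinterval of \<open>(0, T)\<close>. A function that
  annihilates all of them has integral zero over every interval, hence over every Borel set, and so
  vanishes almost everywhere.\<close>

section \<open>Absolutely continuous functions\<close>

lemma absolutely_cont_onE:
  assumes "absolutely_cont_on S f" "\<epsilon> > 0"
  obtains \<delta> where "\<delta> > 0"
    "\<And>P. \<lbrakk>finite P; \<And>u v. (u, v) \<in> P \<Longrightarrow> u \<le> v \<and> {u..v} \<subseteq> S;
       disjoint_family_on (\<lambda>(u, v). {u<..<v}) P; (\<Sum>(u, v)\<in>P. v - u) < \<delta>\<rbrakk>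
       \<Longrightarrow> (\<Sum>(u, v)\<in>P. norm (f v - f u)) < \<epsilon>"
proof -
  obtain \<delta> where "\<delta> > 0" and \<delta>: "\<forall>P. finite P \<and> (\<forall>(u, v)\<in>P. u \<le> v \<and> {u..v} \<subseteq> S) \<and>
      disjoint_family_on (\<lambda>(u, v). {u<..<v}) P \<and> (\<Sum>(u, v)\<in>P. v - u) < \<delta> \<longrightarrow>
      (\<Sum>(u, v)\<in>P. norm (f v - f u)) < \<epsilon>"
    using mp[OF spec[OF assms(1)[unfolded absolutely_cont_on_def]] assms(2)] by (elim exE conjE)
  show ?thesis
    by (rule that[OF \<open>\<delta> > 0\<close>]) (use \<delta> in blast)
qed

lemma absolutely_cont_on_subset:
  assumes "absolutely_cont_on S f" "R \<subseteq> S"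
  shows "absolutely_cont_on R f"
  using assms unfolding absolutely_cont_on_def by (smt (verit) case_prod_beta subset_trans)

lemma absolutely_cont_on_bounded_linear:
  assumes "bounded_linear L" "absolutely_cont_on S f"
  shows "absolutely_cont_on S (\<lambda>t. L (f t))"
  unfolding absolutely_cont_on_def
proof (intro allI impI)
  fix \<epsilon> :: real assume "\<epsilon> > 0"
  obtain K where K: "K > 0" "\<And>v. norm (L v) \<le> norm v * K"
    using bounded_linear.pos_bounded[OF assms(1)] by blast
  have "\<epsilon> / K > 0" using \<open>\<epsilon> > 0\<close> K by simp
  from assms(2) this obtain \<delta> where "\<delta> > 0" and \<delta>:
    "\<And>P. \<lbrakk>finite P; \<And>u v. (u, v) \<in> P \<Longrightarrow> u \<le> v \<and> {u..v} \<subseteq> S;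
       disjoint_family_on (\<lambda>(u, v). {u<..<v}) P; (\<Sum>(u, v)\<in>P. v - u) < \<delta>\<rbrakk>
       \<Longrightarrow> (\<Sum>(u, v)\<in>P. norm (f v - f u)) < \<epsilon> / K"
    using absolutely_cont_onE by blast
  show "\<exists>\<delta>>0. \<forall>P. finite P \<and> (\<forall>(a, b)\<in>P. a \<le> b \<and> {a..b} \<subseteq> S) \<and>
        disjoint_family_on (\<lambda>(a, b). {a<..<b}) P \<and> (\<Sum>(a, b)\<in>P. b - a) < \<delta> \<longrightarrow>
        (\<Sum>(a, b)\<in>P. norm (L (f b) - L (f a))) < \<epsilon>"
  proof (intro exI[of _ \<delta>] conjI allI impI)
    show "\<delta> > 0" by fact
    fix P assume P: "finite P \<and> (\<forall>(a, b)\<in>P. a \<le> b \<and> {a..b} \<subseteq> S) \<and>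
        disjoint_family_on (\<lambda>(a, b). {a<..<b}) P \<and> (\<Sum>(a, b)\<in>P. b - a) < \<delta>"
    have "norm (L (f b) - L (f a)) \<le> norm (f b - f a) * K" for a b
      using K(2)[of "f b - f a"] by (simp add: linear_diff[OF bounded_linear.linear[OF assms(1)]])
    then have "(\<Sum>(a, b)\<in>P. norm (L (f b) - L (f a))) \<le> (\<Sum>(a, b)\<in>P. norm (f b - f a) * K)"
      by (intro sum_mono) auto
    also have "\<dots> = (\<Sum>(a, b)\<in>P. norm (f b - f a)) * K"
      by (simp add: sum_distrib_right case_prod_unfold)
    also have "\<dots> < \<epsilon>"
      using \<delta>[of P] P K by (fastforce simp: pos_less_divide_eq)
    finally show "(\<Sum>(a, b)\<in>P. norm (L (f b) - L (f a))) < \<epsilon>" .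
  qed
qed

lemma absolutely_cont_on_imp_continuous_on:
  assumes "absolutely_cont_on {a..b} f"
  shows "continuous_on {a..b} f"
  unfolding continuous_on_iff
proof (intro ballI allI impI)
  fix x e :: real assume x: "x \<in> {a..b}" and "e > 0"
  from assms \<open>e > 0\<close> obtain d where "d > 0" and d:
    "\<And>P. \<lbrakk>finite P; \<And>u v. (u, v) \<in> P \<Longrightarrow> u \<le> v \<and> {u..v} \<subseteq> {a..b};
       disjoint_family_on (\<lambda>(u, v). {u<..<v}) P; (\<Sum>(u, v)\<in>P. v - u) < d\<rbrakk>
       \<Longrightarrow> (\<Sum>(u, v)\<in>P. norm (f v - f u)) < e"
    using absolutely_cont_onE by blast
  have "dist (f y) (f x) < e" if "y \<in> {a..b}" "dist y x < d" for y
  proof (cases "x \<le> y")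
    case True
    then show ?thesis using d[of "{(x, y)}"] x that by (simp add: disjoint_family_on_def dist_norm)
  next
    case False
    then show ?thesis using d[of "{(y, x)}"] x that
      by (simp add: disjoint_family_on_def dist_norm norm_minus_commute)
  qed
  with \<open>d > 0\<close> show "\<exists>d>0. \<forall>y\<in>{a..b}. dist y x < d \<longrightarrow> dist (f y) (f x) < e" by blast
qed

text \<open>In a Riemann sum over a fine tagged division, an interval whose tag lies outside \<open>N\<close> satisfies
  the straddle estimate, as in the proof for everywhere differentiable functions. The intervals with
  tag in \<open>N\<close> have small total length, because their total length is a Riemann sum of the indicator
  function of \<open>N\<close>, whose integral is zero; absolute continuity then bounds the total increment of
  \<open>f\<close> over them.\<close>

lemma fundamental_theorem_of_calculus_absolutely_cont:
  fixes f :: "real \<Rightarrow> 'a::real_normed_vector"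
  assumes "a \<le> b" and ac: "absolutely_cont_on {a..b} f" and N: "negligible N"
    and der: "\<And>x. x \<in> {a..b} - N \<Longrightarrow> (f has_vector_derivative f' x) (at x within {a..b})"
  shows "(f' has_integral (f b - f a)) {a..b}"
proof -
  define g where "g x = (if x \<in> N then 0 else f' x)" for x
  have "(g has_integral (f b - f a)) {a..b}"
    unfolding has_integral_real
  proof (intro allI impI)
    fix e :: real assume "e > 0"
    \<comment> \<open>Both kinds of intervals are allowed an error of \<open>e / 2\<close>; adding 1 avoids division by zero
      when \<open>a = b\<close>.\<close>
    define \<eta> where "\<eta> = e / (2 * (b - a + 1))"
    have "\<eta> > 0" using \<open>e > 0\<close> \<open>a \<le> b\<close> by (simp add: \<eta>_def)
    have "e / 2 > 0" using \<open>e > 0\<close> by simp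
    from ac this obtain \<delta> where "\<delta> > 0" and \<delta>:
      "\<And>P. \<lbrakk>finite P; \<And>u v. (u, v) \<in> P \<Longrightarrow> u \<le> v \<and> {u..v} \<subseteq> {a..b};
         disjoint_family_on (\<lambda>(u, v). {u<..<v}) P; (\<Sum>(u, v)\<in>P. v - u) < \<delta>\<rbrakk>
         \<Longrightarrow> (\<Sum>(u, v)\<in>P. norm (f v - f u)) < e / 2"
      using absolutely_cont_onE by blast
    have "(indicat_real N has_integral 0) {a..b}"
      using N unfolding negligible_def by (metis box_real(2))
    then obtain \<gamma>1 where "gauge \<gamma>1" and \<gamma>1: "\<And>p. p tagged_division_of {a..b} \<Longrightarrow> \<gamma>1 fine p \<Longrightarrow>
        norm ((\<Sum>(x,k)\<in>p. measure lborel k *\<^sub>R indicat_real N x) - 0) < \<delta>"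
      using \<open>\<delta> > 0\<close> unfolding has_integral_real by meson
    have "\<forall>x. \<exists>d>0. x \<in> {a..b} - N \<longrightarrow>
         (\<forall>y\<in>{a..b}. norm (y-x) < d \<longrightarrow> norm (f y - f x - (y-x) *\<^sub>R f' x) \<le> \<eta> * norm (y-x))"
      using der[unfolded has_vector_derivative_def has_derivative_within_alt] \<open>\<eta> > 0\<close> by blast
    then obtain d where d: "\<And>x. 0 < d x"
        "\<And>x y. \<lbrakk>x \<in> {a..b} - N; y \<in> {a..b}; norm (y-x) < d x\<rbrakk>
                        \<Longrightarrow> norm (f y - f x - (y-x) *\<^sub>R f' x) \<le> \<eta> * norm (y-x)"
      by metis
    have straddle: "norm ((v - u) *\<^sub>R f' x - (f v - f u)) \<le> \<eta> * (v - u)"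
      if "x \<in> {a..b} - N" "x \<in> {u..v}" "{u..v} \<subseteq> {a..b}" "{u..v} \<subseteq> ball x (d x)" for x u v
    proof -
      have "u \<in> {u..v}" "v \<in> {u..v}" using that by auto
      then have "u \<in> ball x (d x)" "v \<in> ball x (d x)" "u \<in> {a..b}" "v \<in> {a..b}"
        using that(3,4) by blast+
      then have uv: "u \<in> {a..b}" "v \<in> {a..b}" "norm (u - x) < d x" "norm (v - x) < d x"
        by (auto simp: dist_norm)
      have "(v - u) *\<^sub>R f' x - (f v - f u)
          = (f u - f x - (u - x) *\<^sub>R f' x) - (f v - f x - (v - x) *\<^sub>R f' x)"
        by (simp add: algebra_simps)
      also have "norm \<dots> \<le> norm (f u - f x - (u - x) *\<^sub>R f' x) + norm (f v - f x - (v - x) *\<^sub>R f' x)"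
        by (rule norm_triangle_ineq4)
      also have "\<dots> \<le> \<eta> * norm (u - x) + \<eta> * norm (v - x)"
        using uv that(1) by (intro add_mono d(2)) auto
      also have "\<dots> = \<eta> * (v - u)" using that by (simp add: algebra_simps)
      finally show ?thesis .
    qed
    show "\<exists>\<gamma>. gauge \<gamma> \<and> (\<forall>p. p tagged_division_of {a..b} \<and> \<gamma> fine p \<longrightarrow>
        norm ((\<Sum>(x,k)\<in>p. measure lborel k *\<^sub>R g x) - (f b - f a)) < e)"
    proof (intro exI conjI allI impI)
      show "gauge (\<lambda>x. \<gamma>1 x \<inter> ball x (d x))"
        using \<open>gauge \<gamma>1\<close> d(1) by (intro gauge_Int gauge_ball_dependent) auto
      fix p assume p: "p tagged_division_of {a..b} \<and> (\<lambda>x. \<gamma>1 x \<inter> ball x (d x)) fine p"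
      then have tag: "p tagged_division_of {a..b}" and fine1: "\<gamma>1 fine p"
        and fine2: "(\<lambda>x. ball x (d x)) fine p"
        by (simp_all add: fine_Int)
      note tagD = tagged_division_ofD[OF tag]
      have K: "{Inf K..Sup K} = K \<and> Inf K \<le> Sup K \<and> measure lborel K = Sup K - Inf K"
        if xK: "(x, K) \<in> p" for x K
      proof -
        obtain u v where "K = {u..v}" using tagD(4)[OF xK] by (auto simp: box_real)
        moreover have "u \<le> v" using tagD(2)[OF xK] calculation by auto
        ultimately show ?thesis by simp
      qed
      have size: "Inf K \<le> Sup K" "measure lborel K = Sup K - Inf K" if "(x, K) \<in> p" for x K
        using K[OF that] by blast+
      \<comment> \<open>Degenerate intervals contribute nothing. Once they are left out, the tag of an interval is
        determined by its endpoints, so sums over \<open>p0\<close> are sums over pairs of endpoints.\<close>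
      define p0 where "p0 = {(x, K) \<in> p. x \<in> N \<and> Inf K < Sup K}"
      define q where "q = (\<lambda>(x, K). (Inf K, Sup K :: real)) ` p0"
      have fin: "finite p" "finite p0" using tagD(1) by (auto simp: p0_def intro: finite_subset)
      have p0p: "p0 \<subseteq> p" by (auto simp: p0_def)
      have intK: "interior K = {Inf K<..<Sup K}" if "(x, K) \<in> p" for x K
        using interior_atLeastAtMost_real[of "Inf K" "Sup K"] K[OF that] by simp
      have inj: "inj_on (\<lambda>(x, K). (Inf K, Sup K :: real)) p0"
      proof (rule inj_onI, clarify)
        fix x K y L assume *: "(x, K) \<in> p0" "(y, L) \<in> p0" "Inf K = Inf L" "Sup K = Sup L"
        then have "K = L" using K p0p by (metis subsetD)
        moreover have "x = y"
        proof (rule ccontr)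
          assume "x \<noteq> y"
          then have "interior K \<inter> interior L = {}" using tagD(5) * p0p by blast
          then have "{Inf K<..<Sup K} = {}" using intK \<open>K = L\<close> * p0p by (metis Int_absorb subsetD)
          then show False using * by (simp add: p0_def)
        qed
        ultimately show "x = y \<and> K = L" by simp
      qed
      have N_sum: "(\<Sum>(x, K)\<in>p0. norm (f (Sup K) - f (Inf K))) < e / 2"
      proof -
        have "(\<Sum>(u, v)\<in>q. norm (f v - f u)) < e / 2"
        proof (rule \<delta>)
          show "finite q" using fin by (simp add: q_def)
          show "u \<le> v \<and> {u..v} \<subseteq> {a..b}" if "(u, v) \<in> q" for u v
          proof -
            have "\<exists>x K. (x, K) \<in> p \<and> u = Inf K \<and> v = Sup K"
              using that p0p by (auto simp: q_def)
            then obtain x K where "(x, K) \<in> p" "u = Inf K" "v = Sup K" by blast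
            then show ?thesis using K tagD(3) by metis
          qed
          show "disjoint_family_on (\<lambda>(u, v). {u<..<v}) q"
            unfolding disjoint_family_on_def q_def
          proof (clarify)
            fix x K y L assume *: "(x, K) \<in> p0" "(y, L) \<in> p0"
              "{Inf K<..<Sup K} \<inter> {Inf L<..<Sup L} \<noteq> {}"
            have "(x, K) = (y, L)"
              using tagD(5)[of x K y L] intK[of x K] intK[of y L] * p0p by auto
            then show "Inf K = Inf L \<and> Sup K = Sup L" by simp
          qed
          have "(\<Sum>(u, v)\<in>q. v - u) = (\<Sum>(x, K)\<in>p0. Sup K - Inf K)"
            unfolding q_def by (subst sum.reindex[OF inj]) (simp add: case_prod_unfold)
          also have "\<dots> = (\<Sum>(x, K)\<in>p0. measure lborel K *\<^sub>R indicat_real N x)"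
            using size by (intro sum.cong) (auto simp: p0_def)
          also have "\<dots> \<le> (\<Sum>(x, K)\<in>p. measure lborel K *\<^sub>R indicat_real N x)"
            using fin p0p by (intro sum_mono2) auto
          also have "\<dots> < \<delta>" using \<gamma>1[OF tag fine1] by auto
          finally show "(\<Sum>(u, v)\<in>q. v - u) < \<delta>" .
        qed
        then show ?thesis
          unfolding q_def by (subst (asm) sum.reindex[OF inj]) (simp add: case_prod_unfold)
      qed
      have ba: "b - a = (\<Sum>(x,K)\<in>p. Sup K - Inf K)" "f b - f a = (\<Sum>(x,K)\<in>p. f(Sup K) - f(Inf K))"
        using additive_tagged_division_1[OF \<open>a \<le> b\<close> tag, of "\<lambda>x. x"]
              additive_tagged_division_1[OF \<open>a \<le> b\<close> tag, of f] by auto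
      have straddle_or_small: "norm (measure lborel K *\<^sub>R g x - (f (Sup K) - f (Inf K)))
          \<le> \<eta> * (Sup K - Inf K) + (if (x, K) \<in> p0 then norm (f (Sup K) - f (Inf K)) else 0)"
        if xK: "(x, K) \<in> p" for x K
      proof (cases "x \<in> N")
        case True
        then show ?thesis
          using size[OF xK] xK \<open>\<eta> > 0\<close>
          by (cases "Inf K < Sup K") (auto simp: g_def p0_def norm_minus_commute)
      next
        case False
        then have "norm ((Sup K - Inf K) *\<^sub>R f' x - (f (Sup K) - f (Inf K))) \<le> \<eta> * (Sup K - Inf K)"
          using K[OF xK] tagD(2,3)[OF xK] fineD[OF fine2 xK] False by (intro straddle) auto
        then show ?thesis using False size[OF xK] by (simp add: g_def p0_def)
      qed
      have "(\<Sum>(x,K)\<in>p. measure lborel K *\<^sub>R g x) - (f b - f a)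
          = (\<Sum>(x,K)\<in>p. measure lborel K *\<^sub>R g x - (f (Sup K) - f (Inf K)))"
        unfolding ba(2) by (simp add: sum_subtractf case_prod_unfold)
      also have "norm \<dots> \<le> (\<Sum>(x,K)\<in>p. \<eta> * (Sup K - Inf K)
          + (if (x, K) \<in> p0 then norm (f (Sup K) - f (Inf K)) else 0))"
        using straddle_or_small by (intro sum_norm_le) auto
      also have "\<dots> = \<eta> * (b - a) + (\<Sum>(x,K)\<in>p0. norm (f (Sup K) - f (Inf K)))"
        unfolding ba(1) using fin p0p
        by (simp add: sum.distrib sum_distrib_left case_prod_unfold sum.inter_restrict[symmetric] Int_absorb1)
      also have "\<dots> < \<eta> * (b - a) + e / 2" using N_sum by simp
      also have "\<dots> \<le> e"
        using \<open>e > 0\<close> \<open>a \<le> b\<close> by (simp add: \<eta>_def field_simps)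
      finally show "norm ((\<Sum>(x,K)\<in>p. measure lborel K *\<^sub>R g x) - (f b - f a)) < e" .
    qed
  qed
  then show ?thesis
    by (rule has_integral_spike[OF N, rotated]) (simp add: g_def)
qed

text \<open>Continuity of \<open>z\<close> upgrades the almost everywhere derivative: \<open>y\<close> is an indefinite integral
  of \<open>z\<close>, which is differentiable at every point.\<close>

lemma has_vector_derivative_if_AE:
  fixes y z :: "real \<Rightarrow> 'a::banach"
  assumes ac: "absolutely_cont_on {a..b} y" and cont: "continuous_on {a..b} z"
    and der: "AE t in lebesgue_on {a<..<b}. (y has_vector_derivative z t) (at t)"
    and t: "t \<in> {a..b}"
  shows "(y has_vector_derivative z t) (at t within {a..b})"
proof -
  have "AE t in lebesgue. t \<in> {a<..<b} \<longrightarrow> (y has_vector_derivative z t) (at t)"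
    using der by (subst (asm) AE_restrict_space_iff) auto
  then obtain M where "M \<in> null_sets lebesgue"
    and M: "{t. \<not> (t \<in> {a<..<b} \<longrightarrow> (y has_vector_derivative z t) (at t))} \<subseteq> M"
    by (auto elim: AE_E3 simp: eventually_ae_filter)
  then have "negligible (M \<union> {a, b})"
    by (simp add: negligible_iff_null_sets)
  have y_eq: "y s = y a + integral {a..s} z" if s: "s \<in> {a..b}" for s
  proof -
    have "(z has_integral y s - y a) {a..s}"
    proof (rule fundamental_theorem_of_calculus_absolutely_cont)
      show "a \<le> s" using s by simp
      show "absolutely_cont_on {a..s} y"
        by (rule absolutely_cont_on_subset[OF ac]) (use s in auto)
      show "negligible (M \<union> {a, b})" by fact
      fix x assume "x \<in> {a..s} - (M \<union> {a, b})"
      then have "x \<in> {a<..<b}" "x \<notin> M" using s by auto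
      then have "(y has_vector_derivative z x) (at x)" using M by blast
      then show "(y has_vector_derivative z x) (at x within {a..s})"
        by (rule has_vector_derivative_at_within)
    qed
    then show ?thesis by (simp add: integral_unique)
  qed
  have "((\<lambda>s. y a + integral {a..s} z) has_vector_derivative z t) (at t within {a..b})"
    using has_vector_derivative_add[OF has_vector_derivative_const integral_has_vector_derivative[OF cont t]]
    by simp
  from has_vector_derivative_transform[OF t y_eq this] show ?thesis .
qed

section \<open>Distributional derivatives of continuously differentiable functions\<close>

lemma test_functionsD:
  assumes "\<phi> \<in> test_functions T"
  shows "(\<phi> has_real_derivative deriv \<phi> t) (at t)" "continuous_on S \<phi>" "continuous_on S (deriv \<phi>)"
    "t \<notin> {0<..<T} \<Longrightarrow> \<phi> t = 0"
proof -
  have d: "\<phi> field_differentiable (at t)" "deriv \<phi> field_differentiable (at t)" for t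
  proof -
    have "(deriv ^^ k) \<phi> field_differentiable (at t)" for k
      using assms by (simp add: test_functions_def)
    from this[of 0] this[of 1] show "\<phi> field_differentiable (at t)" "deriv \<phi> field_differentiable (at t)"
      by simp_all
  qed
  show "(\<phi> has_real_derivative deriv \<phi> t) (at t)"
    using d(1) by (simp add: DERIV_deriv_iff_field_differentiable)
  show "continuous_on S \<phi>" "continuous_on S (deriv \<phi>)"
    by (intro continuous_at_imp_continuous_on ballI field_differentiable_imp_continuous_at d)+
  show "\<phi> t = 0" if "t \<notin> {0<..<T}"
    using assms that closure_subset[of "{t. \<phi> t \<noteq> 0}"] by (auto simp: test_functions_def)
qed

lemma distribution_of_cong_AE:
  assumes "f \<in> borel_measurable (lebesgue_on {0<..<T})" "g \<in> borel_measurable (lebesgue_on {0<..<T})"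
    and "AE t in lebesgue_on {0<..<T}. f t = g t" and "continuous_on {0<..<T} \<phi>"
  shows "distribution_of T f \<phi> = distribution_of T g \<phi>"
proof -
  have [measurable]: "\<phi> \<in> borel_measurable (lebesgue_on {0<..<T})"
    by (rule continuous_imp_measurable_on_sets_lebesgue) (use assms in auto)
  note assms(1,2)[measurable]
  show ?thesis
    unfolding distribution_of_def by (rule integral_cong_AE) (use assms(3) in auto)
qed

lemma has_distributional_derivative_cong_AE:
  assumes "f \<in> borel_measurable (lebesgue_on {0<..<T})" "y \<in> borel_measurable (lebesgue_on {0<..<T})"
    and "g \<in> borel_measurable (lebesgue_on {0<..<T})" "z \<in> borel_measurable (lebesgue_on {0<..<T})"
    and "AE t in lebesgue_on {0<..<T}. y t = f t" "AE t in lebesgue_on {0<..<T}. z t = g t"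
    and "has_distributional_derivative T y z"
  shows "has_distributional_derivative T f g"
  unfolding has_distributional_derivative_def distribution_deriv_def
proof
  fix \<phi> assume \<phi>: "\<phi> \<in> test_functions T"
  note D = test_functionsD[OF \<phi>]
  show "distribution_of T g \<phi> = - distribution_of T f (deriv \<phi>)"
    using assms(7) \<phi> distribution_of_cong_AE[OF assms(2,1,5) D(3)]
      distribution_of_cong_AE[OF assms(4,3,6) D(2)]
    by (simp add: has_distributional_derivative_def distribution_deriv_def)
qed

lemma continuous_on_integral_lebesgue_on_Ioo:
  fixes f :: "real \<Rightarrow> 'a::euclidean_space"
  assumes "continuous_on {a..b} f"
  shows "integral\<^sup>L (lebesgue_on {a<..<b}) f = integral {a..b} f"
proof -
  have "f absolutely_integrable_on {a<..<b}"
    using absolutely_integrable_continuous_real[OF assms]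
    by (rule set_integrable_subset) auto
  then have "integrable (lebesgue_on {a<..<b}) f"
    by (simp add: set_integrable_def integrable_restrict_space)
  then show ?thesis
    by (simp add: lebesgue_integral_eq_integral integral_open_interval_real)
qed

text \<open>Integration by parts; the boundary terms vanish since a test function is zero at \<open>0\<close> and
  \<open>T\<close>.\<close>

lemma has_distributional_derivative_if_C1:
  assumes "0 \<le> T" and cont: "continuous_on {0..T} z"
    and der: "\<And>t. t \<in> {0..T} \<Longrightarrow> (y has_real_derivative z t) (at t within {0..T})"
  shows "has_distributional_derivative T y z"
  unfolding has_distributional_derivative_def distribution_deriv_def distribution_of_def
proof
  fix \<phi> assume \<phi>: "\<phi> \<in> test_functions T"
  note D = test_functionsD[OF \<phi>]
  have conty: "continuous_on {0..T} y"
    using der by (intro DERIV_continuous_on) auto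
  have c: "continuous_on {0..T} (\<lambda>t. z t * \<phi> t)" "continuous_on {0..T} (\<lambda>t. y t * deriv \<phi> t)"
    using conty cont by (auto intro!: continuous_intros D)
  have "((\<lambda>t. z t * \<phi> t + y t * deriv \<phi> t) has_integral (y T * \<phi> T - y 0 * \<phi> 0)) {0..T}"
  proof (rule fundamental_theorem_of_calculus[OF \<open>0 \<le> T\<close>])
    fix t assume "t \<in> {0..T}"
    from DERIV_mult[OF der[OF this] DERIV_subset[OF D(1) subset_UNIV]]
    show "((\<lambda>t. y t * \<phi> t) has_vector_derivative z t * \<phi> t + y t * deriv \<phi> t) (at t within {0..T})"
      by (simp add: has_real_derivative_iff_has_vector_derivative algebra_simps)
  qed
  then have "integral {0..T} (\<lambda>t. z t * \<phi> t + y t * deriv \<phi> t) = 0"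
    using D(4)[of 0] D(4)[of T] by (simp add: integral_unique)
  then have "integral {0..T} (\<lambda>t. z t * \<phi> t) = - integral {0..T} (\<lambda>t. y t * deriv \<phi> t)"
    using c by (simp add: Henstock_Kurzweil_Integration.integral_add integrable_continuous_real)
  then show "(LINT t|lebesgue_on {0<..<T}. z t * \<phi> t) = - (LINT t|lebesgue_on {0<..<T}. y t * deriv \<phi> t)"
    using c by (simp add: continuous_on_integral_lebesgue_on_Ioo)
qed

lemma bounded_linear_sys_output: "bounded_linear (sys_output C)"
  unfolding sys_output_def
  by (intro bounded_linear_compose[OF bounded_linear_vec_nth] matrix_vector_mul_bounded_linear)

section \<open>Smooth bump functions\<close>

text \<open>The polynomial factor makes the family closed under differentiation, so that one computation
  of a derivative covers all derivatives of the classical flat function \<open>flat_exp 1\<close>.\<close>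

definition flat_exp :: "real poly \<Rightarrow> real \<Rightarrow> real" where
  "flat_exp p t = (if t > 0 then poly p (1 / t) * exp (- (1 / t)) else 0)"

lemma poly_times_exp_minus_tendsto_0:
  fixes p :: "real poly"
  shows "((\<lambda>x. poly p x * exp (- x)) \<longlongrightarrow> 0) at_top"
proof -
  have "((\<lambda>x. \<Sum>i\<le>degree p. coeff p i * (x ^ i / exp x)) \<longlongrightarrow> (\<Sum>i\<le>degree p. coeff p i * 0)) at_top"
    by (intro tendsto_intros tendsto_power_div_exp_0)
  then show ?thesis
    by (simp add: poly_altdef exp_minus divide_inverse sum_distrib_right mult.assoc)
qed

text \<open>For \<open>t > 0\<close> the chain rule for \<open>s = 1 / t\<close> produces the factor \<open>- s\<^sup>2\<close>, and
  \<open>(p exp (- s))' = (p' - p) exp (- s)\<close>. At \<open>0\<close> the difference quotient from the right is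
  \<open>s p(s) exp (- s)\<close> with \<open>s \<rightarrow> \<infinity>\<close>, which tends to zero.\<close>

lemma DERIV_flat_exp:
  "(flat_exp p has_real_derivative flat_exp ([:0, 0, 1:] * (p - pderiv p)) t) (at t)"
proof (cases t "0 :: real" rule: linorder_cases)
  case greater
  have "((\<lambda>t. poly p (1 / t) * exp (- (1 / t))) has_real_derivative
      flat_exp ([:0, 0, 1:] * (p - pderiv p)) t) (at t)"
    using greater
    by (auto simp: flat_exp_def field_simps power2_eq_square
        intro!: derivative_eq_intros DERIV_chain2[OF poly_DERIV])
  then show ?thesis
    by (rule has_field_derivative_transform_within_open[of _ _ _ "{0<..}"])
      (use greater in \<open>auto simp: flat_exp_def\<close>)
next
  case less
  have "((\<lambda>t. 0) has_real_derivative 0) (at t)" by simp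
  then show ?thesis
    using less by (auto simp: flat_exp_def
        intro: has_field_derivative_transform_within_open[of "\<lambda>_. 0" _ _ "{..<0}"])
next
  case equal
  have "((\<lambda>x. poly (pCons 0 p) x * exp (- x)) \<longlongrightarrow> 0) at_top"
    by (rule poly_times_exp_minus_tendsto_0)
  then have "((\<lambda>h. poly (pCons 0 p) (inverse h) * exp (- inverse h)) \<longlongrightarrow> 0) (at_right (0::real))"
    by (rule filterlim_compose[OF _ filterlim_inverse_at_top_right])
  then have "((\<lambda>h. flat_exp p h / h) \<longlongrightarrow> 0) (at_right 0)"
    by (rule Lim_transform_eventually)
      (auto simp: eventually_at_filter flat_exp_def field_simps)
  moreover have "((\<lambda>h. flat_exp p h / h) \<longlongrightarrow> 0) (at_left 0)"
    by (rule Lim_transform_eventually[OF tendsto_const])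
      (auto simp: eventually_at_filter flat_exp_def)
  ultimately have "((\<lambda>h. flat_exp p h / h) \<longlongrightarrow> 0) (at 0)"
    by (simp add: filterlim_split_at_real)
  then show ?thesis
    unfolding equal DERIV_def by (simp add: flat_exp_def)
qed

text \<open>Smoothness by coinduction: every iterated derivative of a member of \<open>\<F>\<close> is again a member
  of \<open>\<F>\<close>.\<close>

lemma higher_deriv_differentiable_if_closed_under_deriv:
  assumes "f \<in> \<F>" and "\<And>f. f \<in> \<F> \<Longrightarrow> \<exists>f'\<in>\<F>. \<forall>t. (f has_field_derivative f' t) (at t)"
  shows "(deriv ^^ k) f field_differentiable (at t)"
proof -
  have "(deriv ^^ k) f \<in> \<F>"
  proof (induction k)
    case 0
    then show ?case using assms(1) by simp
  next
    case (Suc k)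
    then obtain f' where "f' \<in> \<F>" "\<forall>t. ((deriv ^^ k) f has_field_derivative f' t) (at t)"
      using assms(2) by blast
    moreover from this(2) have "deriv ((deriv ^^ k) f) = f'"
      by (auto intro: DERIV_imp_deriv)
    ultimately show ?case by simp
  qed
  then show ?thesis
    using assms(2) by (auto simp: field_differentiable_def)
qed

text \<open>By the product rule, finite sums of products of this form are closed under differentiation.
  The polynomials \<open>p\<close> and \<open>q\<close> absorb the inner derivatives \<open>m\<close> and \<open>- m\<close>.\<close>

lemma smooth_flat_exp_product:
  fixes m c d :: real
  shows "(deriv ^^ k) (\<lambda>t. flat_exp p (m * t + c) * flat_exp q (d - m * t)) field_differentiable (at t)"
proof (rule higher_deriv_differentiable_if_closed_under_deriv)
  define g where "g p q t = flat_exp p (m * t + c) * flat_exp q (d - m * t)" for p q t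
  let ?\<F> = "{f. \<exists>rs. f = (\<lambda>t. \<Sum>(p, q)\<leftarrow>rs. g p q t)}"
  show "(\<lambda>t. flat_exp p (m * t + c) * flat_exp q (d - m * t)) \<in> ?\<F>"
    by (auto simp: g_def intro!: exI[of _ "[(p, q)]"])
  define D where "D p = [:0, 0, 1:] * (p - pderiv p)" for p :: "real poly"
  have g: "(g p q has_real_derivative (g (smult m (D p)) q t + g p (smult (- m) (D q)) t)) (at t)" for p q t
    unfolding g_def
    by (rule derivative_eq_intros DERIV_chain2[OF DERIV_flat_exp] refl)+
      (auto simp: D_def flat_exp_def algebra_simps)
  fix f assume "f \<in> ?\<F>"
  then obtain rs where rs: "f = (\<lambda>t. \<Sum>(p, q)\<leftarrow>rs. g p q t)" by blast
  have "\<exists>rs'. \<forall>t. ((\<lambda>t. \<Sum>(p, q)\<leftarrow>rs. g p q t) has_real_derivative (\<Sum>(p, q)\<leftarrow>rs'. g p q t)) (at t)"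
  proof (induction rs)
    case Nil
    then show ?case by (auto intro!: exI[of _ "[]"])
  next
    case (Cons r rs)
    obtain p q where r: "r = (p, q)" by force
    from Cons obtain rs' where
      "((\<lambda>t. \<Sum>(p, q)\<leftarrow>rs. g p q t) has_real_derivative (\<Sum>(p, q)\<leftarrow>rs'. g p q t)) (at t)" for t by blast
    from DERIV_add[OF g[of p q] this] show ?case
      by (intro exI[of _ "(smult m (D p), q) # (p, smult (- m) (D q)) # rs'"]) (simp add: r add.assoc)
  qed
  then obtain rs' where "\<forall>t. (f has_real_derivative (\<Sum>(p, q)\<leftarrow>rs'. g p q t)) (at t)"
    unfolding rs by blast
  then show "\<exists>f'\<in>?\<F>. \<forall>t. (f has_real_derivative f' t) (at t)"
    by (intro bexI[of _ "\<lambda>t. \<Sum>(p, q)\<leftarrow>rs'. g p q t"]) auto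
qed

text \<open>The shift by \<open>1\<close> keeps the support, for \<open>n > 0\<close>, at distance at least \<open>1 / n\<close> from \<open>a\<close> and
  \<open>b\<close>. So the intervals may reach up to the ends of \<open>(0, T)\<close>, although the support of a test function
  has to be a compact subset of the open interval.\<close>

definition bump :: "real \<Rightarrow> real \<Rightarrow> nat \<Rightarrow> real \<Rightarrow> real" where
  "bump a b n t = flat_exp 1 (real n * (t - a) - 1) * flat_exp 1 (real n * (b - t) - 1)"

lemma bump_bounds: "0 \<le> bump a b n t" "bump a b n t \<le> 1"
  by (auto simp: bump_def flat_exp_def intro: mult_le_one)

lemma bump_nonzeroD: 
  assumes "bump a b (Suc n) t \<noteq> 0"
  shows "t \<in> {a + 1 / Suc n..b - 1 / Suc n}"
proof -
  have "real (Suc n) * (t - a) - 1 > 0" "real (Suc n) * (b - t) - 1 > 0"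
    using assms by (auto simp: bump_def flat_exp_def split: if_splits)
  then show ?thesis by (simp add: field_simps del: of_nat_Suc)
qed

lemma bump_in_test_functions:
  assumes "0 \<le> a" "b \<le> T"
  shows "bump a b (Suc n) \<in> test_functions T"
proof -
  let ?f = "bump a b (Suc n)"
  have sub: "closure {t. ?f t \<noteq> 0} \<subseteq> {a + 1 / Suc n..b - 1 / Suc n}"
    by (rule closure_minimal) (use bump_nonzeroD in auto)
  have "?f = (\<lambda>t. flat_exp 1 (real (Suc n) * t + (- real (Suc n) * a - 1))
                 * flat_exp 1 ((real (Suc n) * b - 1) - real (Suc n) * t))"
    by (auto simp: bump_def algebra_simps)
  then have "(deriv ^^ k) ?f field_differentiable (at t)" for k t
    using smooth_flat_exp_product by presburger
  moreover have "compact (closure {t. ?f t \<noteq> 0})"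
    unfolding compact_closure
    by (rule bounded_subset[OF bounded_closed_interval]) (use bump_nonzeroD in blast)
  moreover have "{a + 1 / Suc n..b - 1 / Suc n} \<subseteq> {0<..<T}"
  proof
    fix t assume "t \<in> {a + 1 / Suc n..b - 1 / Suc n}"
    moreover have "1 / real (Suc n) > 0" by simp
    ultimately show "t \<in> {0<..<T}" using assms unfolding atLeastAtMost_iff greaterThanLessThan_iff by linarith
  qed
  ultimately show ?thesis
    using sub by (auto simp: test_functions_def)
qed

lemma flat_exp_1_tendsto: "(flat_exp 1 \<longlongrightarrow> 1) at_top"
proof -
  have "((\<lambda>t::real. exp (- (1 / t))) \<longlongrightarrow> exp (- 0)) at_top"
    by (intro tendsto_intros real_tendsto_divide_at_top[OF tendsto_const filterlim_ident])
  then show ?thesis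
    by (rule Lim_transform_eventually[THEN tendsto_eq_rhs])
      (auto simp: flat_exp_def eventually_at_top_dense intro!: exI[of _ 0])
qed

lemma bump_tendsto: "(\<lambda>n. bump a b (Suc n) t) \<longlonglongrightarrow> indicator {a<..<b} t"
proof (cases "t \<in> {a<..<b}")
  case True
  have *: "filterlim (\<lambda>n. real (Suc n) * c - 1) at_top sequentially" if "c > 0" for c :: real
  proof -
    have "filterlim (\<lambda>n. -1 + c * real (Suc n)) at_top sequentially"
      using that
      by (intro filterlim_tendsto_add_at_top[OF tendsto_const]
          filterlim_tendsto_pos_mult_at_top[OF tendsto_const that]
          filterlim_compose[OF filterlim_real_sequentially filterlim_Suc])
    then show ?thesis by (simp add: mult.commute)
  qed
  have "(\<lambda>n. bump a b (Suc n) t) \<longlonglongrightarrow> 1 * 1"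
    unfolding bump_def using True
    by (intro tendsto_mult filterlim_compose[OF flat_exp_1_tendsto] *) auto
  then show ?thesis using True by simp
next
  case False
  have "bump a b (Suc n) t = 0" for n
  proof (rule ccontr)
    assume "bump a b (Suc n) t \<noteq> 0"
    then have "t \<in> {a + 1 / Suc n..b - 1 / Suc n}" by (rule bump_nonzeroD)
    moreover have "1 / real (Suc n) > 0" by simp
    ultimately show False using False unfolding atLeastAtMost_iff greaterThanLessThan_iff by linarith
  qed
  then show ?thesis using False by simp
qed

section \<open>Uniqueness of the distributional derivative\<close>

text \<open>The Borel sets over which \<open>f\<close> has integral zero form a Dynkin system. It contains the open
  intervals, which generate the Borel sets and are closed under intersection.\<close>

lemma AE_eq_0_if_integral_Ioo_eq_0:
  fixes f :: "real \<Rightarrow> real"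
  assumes f: "integrable lebesgue f"
    and int0: "\<And>a b. (LINT x|lebesgue. indicator {a<..<b} x * f x) = 0"
  shows "AE x in lebesgue. f x = 0"
proof -
  \<comment> \<open>A Borel representative \<open>h\<close> of \<open>f\<close> reduces the claim to Borel sets.\<close>
  obtain h where [measurable]: "h \<in> borel_measurable borel" and fh: "AE x in lborel. f x = h x"
    using completion_ex_borel_measurable_real[OF borel_measurable_integrable[OF f]] by auto
  have fh': "AE x in lebesgue. f x = h x" using fh by (rule AE_completion)
  have [measurable]: "h \<in> borel_measurable lebesgue" by (simp add: measurable_completion)
  have h: "integrable lborel h"
    using integrable_cong_AE[of f lebesgue h] f fh' integrable_completion[of h lborel] by auto
  have h_int: "integrable lborel (\<lambda>x. indicator A x * h x)" if "A \<in> sets borel" for A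
    using integrable_mult_indicator[OF _ h, of A] that by simp
  have h_Ioo: "(LINT x|lborel. indicator {a<..<b} x * h x) = 0" for a b
  proof -
    note borel_measurable_integrable[OF f, measurable]
    have [measurable]: "{a<..<b} \<in> sets lebesgue" by simp
    have "(LINT x|lborel. indicator {a<..<b} x * h x) = (LINT x|lebesgue. indicator {a<..<b} x * h x)"
      by (rule integral_completion[symmetric]) auto
    also have "\<dots> = (LINT x|lebesgue. indicator {a<..<b} x * f x)"
      using f fh' by (intro integral_cong_AE) auto
    finally show ?thesis using int0 by simp
  qed
  have h_UNIV: "(LINT x|lborel. h x) = 0"
  proof -
    have "(\<lambda>n. LINT x|lborel. indicator {- real n<..<real n} x * h x) \<longlonglongrightarrow> (LINT x|lborel. h x)"
    proof (rule integral_dominated_convergence[where w = "\<lambda>x. \<bar>h x\<bar>"])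
      show "AE x in lborel. (\<lambda>n. indicator {- real n<..<real n} x * h x) \<longlonglongrightarrow> h x"
      proof (rule AE_I2, rule tendsto_eventually)
        fix x :: real
        obtain n where "real n > \<bar>x\<bar>" using reals_Archimedean2 by blast
        then show "\<forall>\<^sub>F n in sequentially. indicator {- real n<..<real n} x * h x = h x"
          by (intro eventually_sequentiallyI[of n]) (auto simp: indicator_def)
      qed
    qed (use h in \<open>auto simp: indicator_def\<close>)
    then show ?thesis using h_Ioo by (simp add: LIMSEQ_const_iff)
  qed
  have h0: "(LINT x|lborel. indicator A x * h x) = 0" if A: "A \<in> sets borel" for A
  proof -
    have "Int_stable (range (\<lambda>(a, b). {a<..<b::real}))"
      by (auto simp: Int_stable_def)
    moreover have "(range (\<lambda>(a, b). {a<..<b::real})) \<subseteq> Pow UNIV" by auto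
    moreover have "A \<in> sigma_sets UNIV (range (\<lambda>(a, b). {a<..<b::real}))"
      using A unfolding borel_eq_box box_real by simp
    ultimately show ?thesis
    proof (induction rule: sigma_sets_induct_disjoint)
      case (basic A)
      then show ?case using h_Ioo by auto
    next
      case empty
      then show ?case by simp
    next
      case (compl A)
      then have A: "A \<in> sets borel" by (simp add: borel_eq_box box_real)
      have "(LINT x|lborel. indicator (UNIV - A) x * h x) = (LINT x|lborel. h x - indicator A x * h x)"
        by (intro Bochner_Integration.integral_cong) (auto simp: indicator_def)
      also have "\<dots> = 0" using h h_int[OF A] h_UNIV compl by simp
      finally show ?case .
    next
      case (union F)
      then have F: "F i \<in> sets borel" for i by (auto simp: borel_eq_box box_real)
      have "(LINT x:(\<Union>i. F i)|lborel. h x) = (\<Sum>i. (LINT x:(F i)|lborel. h x))"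
        using union(1) F h_int[of "\<Union>i. F i"]
        by (intro lebesgue_integral_countable_add)
          (auto simp: disjoint_family_on_def set_integrable_def)
      then show ?case using union by (simp add: set_lebesgue_integral_def)
    qed
  qed
  have "AE x in lborel. h x = 0"
    by (rule sigma_finite_measure.density_zero[OF sigma_finite_lborel h]) (use h0 in \<open>simp add: set_lebesgue_integral_def\<close>)
  then have "AE x in lborel. f x = 0" using fh by auto
  then show ?thesis by (rule AE_completion)
qed

text \<open>Bump functions converge to the indicator function of an interval and are bounded by \<open>1\<close>, so
  dominated convergence carries the vanishing of \<open>f\<close> from test functions to intervals.\<close>

lemma fundamental_lemma_calculus_of_variations:
  assumes f: "integrable (lebesgue_on {0<..<T}) f"
    and zero: "\<And>\<phi>. \<phi> \<in> test_functions T \<Longrightarrow> distribution_of T f \<phi> = 0"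
  shows "AE t in lebesgue_on {0<..<T}. f t = 0"
proof -
  define h where "h t = indicator {0<..<T} t * f t" for t
  have h: "integrable lebesgue h"
    using f by (simp add: integrable_restrict_space h_def[abs_def])
  have "AE t in lebesgue. h t = 0"
  proof (rule AE_eq_0_if_integral_Ioo_eq_0[OF h])
    fix a b :: real
    define \<phi> where "\<phi> n = bump (max a 0) (min b T) (Suc n)" for n
    have \<phi>: "\<phi> n \<in> test_functions T" for n
      unfolding \<phi>_def by (rule bump_in_test_functions) auto
    have [measurable]: "\<phi> n \<in> borel_measurable lebesgue" for n
      using continuous_imp_measurable_on_sets_lebesgue[OF test_functionsD(2)[OF \<phi>[of n]], of UNIV] by simp
    have [measurable]: "{a<..<b} \<in> sets lebesgue" by simp
    note borel_measurable_integrable[OF h, measurable]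
    have "(\<lambda>n. LINT t|lebesgue. \<phi> n t * h t) \<longlonglongrightarrow> (LINT t|lebesgue. indicator {a<..<b} t * h t)"
    proof (rule integral_dominated_convergence[where w = "\<lambda>t. \<bar>h t\<bar>"])
      show "integrable lebesgue (\<lambda>t. \<bar>h t\<bar>)" using h by simp
      show "AE t in lebesgue. (\<lambda>n. \<phi> n t * h t) \<longlonglongrightarrow> indicator {a<..<b} t * h t"
      proof (rule AE_I2)
        fix t
        have "(\<lambda>n. \<phi> n t * h t) \<longlonglongrightarrow> indicator {max a 0<..<min b T} t * h t"
          unfolding \<phi>_def by (intro tendsto_mult_right bump_tendsto)
        also have "indicator {max a 0<..<min b T} t * h t = indicator {a<..<b} t * h t"
          by (auto simp: h_def indicator_def)
        finally show "(\<lambda>n. \<phi> n t * h t) \<longlonglongrightarrow> indicator {a<..<b} t * h t" .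
      qed
      show "AE t in lebesgue. norm (\<phi> n t * h t) \<le> \<bar>h t\<bar>" for n
        using bump_bounds by (auto simp: \<phi>_def abs_mult intro!: mult_left_le_one_le)
    qed measurable
    moreover have "(LINT t|lebesgue. \<phi> n t * h t) = 0" for n
      using zero[OF \<phi>[of n]]
      by (simp add: distribution_of_def integral_restrict_space h_def mult_ac)
    ultimately show "(LINT t|lebesgue. indicator {a<..<b} t * h t) = 0"
      by (simp add: LIMSEQ_const_iff)
  qed
  then show ?thesis
    by (subst AE_restrict_space_iff) (auto simp: h_def)
qed

text \<open>The interval has finite measure, and \<open>\<bar>x\<bar> \<le> 1 + x\<^sup>2\<close>.\<close>

lemma in_L2_imp_integrable:
  assumes "in_L2 T f"
  shows "integrable (lebesgue_on {0<..<T}) f"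
proof (rule Bochner_Integration.integrable_bound)
  have "integrable (lebesgue_on {0<..<T}) (\<lambda>t. 1 :: real)"
    using lmeasurable_box[of 0 T] by (simp add: integrable_restrict_space lmeasurable_iff_integrable)
  then show "integrable (lebesgue_on {0<..<T}) (\<lambda>t. 1 + (f t)\<^sup>2)"
    using assms by (auto simp: in_L2_def)
  show "f \<in> borel_measurable (lebesgue_on {0<..<T})"
    using assms by (simp add: in_L2_def)
  have "\<bar>x\<bar> \<le> 1 + x\<^sup>2" for x :: real
    using zero_le_power2[of "\<bar>x\<bar> - 1"] by (simp add: power2_diff) 
  then show "AE t in lebesgue_on {0<..<T}. norm (f t) \<le> norm (1 + (f t)\<^sup>2)"
    by (simp add: add_nonneg_nonneg)
qed

lemma integrable_times_test_function:
  assumes "in_L2 T f" "\<phi> \<in> test_functions T"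
  shows "integrable (lebesgue_on {0<..<T}) (\<lambda>t. f t * \<phi> t)"
proof -
  note D = test_functionsD[OF assms(2)]
  have "bounded (\<phi> ` {0..T})"
    by (intro compact_imp_bounded compact_continuous_image D) simp
  then obtain B where "\<forall>t\<in>{0..T}. norm (\<phi> t) \<le> B"
    by (auto simp: bounded_iff)
  then have B: "\<bar>\<phi> t\<bar> \<le> \<bar>B\<bar>" for t
  proof (cases "t \<in> {0..T}")
    case True
    then have "\<bar>\<phi> t\<bar> \<le> B" using \<open>\<forall>t\<in>{0..T}. norm (\<phi> t) \<le> B\<close> by simp
    then show ?thesis by linarith
  next
    case False
    then have "\<phi> t = 0" by (intro D(4)) auto
    then show ?thesis by simp
  qed
  have [measurable]: "f \<in> borel_measurable (lebesgue_on {0<..<T})"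
    "\<phi> \<in> borel_measurable (lebesgue_on {0<..<T})"
    using assms(1) by (auto simp: in_L2_def intro!: continuous_imp_measurable_on_sets_lebesgue D)
  show ?thesis
  proof (rule Bochner_Integration.integrable_bound)
    show "integrable (lebesgue_on {0<..<T}) (\<lambda>t. f t * B)"
      using in_L2_imp_integrable[OF assms(1)] by simp
    show "AE t in lebesgue_on {0<..<T}. norm (f t * \<phi> t) \<le> norm (f t * B)"
      using B by (intro AE_I2) (simp add: abs_mult mult_left_mono)
  qed measurable
qed

lemma distributional_derivative_unique:
  assumes "in_L2 T g" "in_L2 T h"
    and "has_distributional_derivative T f g" "has_distributional_derivative T f h"
  shows "AE t in lebesgue_on {0<..<T}. g t = h t"
proof -
  have "AE t in lebesgue_on {0<..<T}. g t - h t = 0"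
  proof (rule fundamental_lemma_calculus_of_variations)
    show "integrable (lebesgue_on {0<..<T}) (\<lambda>t. g t - h t)"
      using assms by (intro Bochner_Integration.integrable_diff in_L2_imp_integrable)
    fix \<phi> assume \<phi>: "\<phi> \<in> test_functions T"
    have "distribution_of T (\<lambda>t. g t - h t) \<phi> = distribution_of T g \<phi> - distribution_of T h \<phi>"
      unfolding distribution_of_def left_diff_distrib
      using assms \<phi> by (intro Bochner_Integration.integral_diff integrable_times_test_function)
    then show "distribution_of T (\<lambda>t. g t - h t) \<phi> = 0"
      using assms \<phi> by (simp add: has_distributional_derivative_def)
  qed
  then show ?thesis by simp
qed

section \<open>Compatibility of trackable targets\<close>

theorem proposition5p3:
  fixes T :: real and A :: "real^'n^'n" and b :: "real^'n::finite"
    and C1 C2 :: "real^'n^1"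
  assumes "T > 0"
    and "controllable A b"
    and "\<And>u x. is_trajectory T A b u x \<Longrightarrow>
           (AE t in lebesgue_on {0<..<T}.
              ((\<lambda>s. sys_output C1 (x s)) has_real_derivative sys_output C2 (x t)) (at t))"
  shows "\<forall>f1 f2. exactly_output_trackable T A b C1 C2 f1 f2 \<longrightarrow>
           has_distributional_derivative T f1 f2 \<and>
           (in_H1 T f1 \<longrightarrow>
              (\<forall>g. in_L2 T g \<and> has_distributional_derivative T f1 g \<longrightarrow>
                 (AE t in lebesgue_on {0<..<T}. f2 t = g t)))"
proof (intro allI impI)
  fix f1 f2 assume track: "exactly_output_trackable T A b C1 C2 f1 f2"
  then obtain u x where traj: "is_trajectory T A b u x"
    and f1: "AE t in lebesgue_on {0<..<T}. sys_output C1 (x t) = f1 t"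
    and f2: "AE t in lebesgue_on {0<..<T}. sys_output C2 (x t) = f2 t"
    and L2: "in_L2 T f1" "in_L2 T f2"
    unfolding exactly_output_trackable_def by blast
  define y z where "y t = sys_output C1 (x t)" and "z t = sys_output C2 (x t)" for t
  have ac: "absolutely_cont_on {0..T} x"
    using traj by (simp add: is_trajectory_def)
  have cont: "continuous_on {0..T} y" "continuous_on {0..T} z"
    unfolding y_def z_def
    by (intro bounded_linear.continuous_on[OF bounded_linear_sys_output]
        absolutely_cont_on_imp_continuous_on[OF ac])+
  have "(y has_vector_derivative z t) (at t within {0..T})" if "t \<in> {0..T}" for t
  proof (rule has_vector_derivative_if_AE[OF _ cont(2) _ that])
    show "absolutely_cont_on {0..T} y"
      unfolding y_def by (rule absolutely_cont_on_bounded_linear[OF bounded_linear_sys_output ac])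
    show "AE t in lebesgue_on {0<..<T}. (y has_vector_derivative z t) (at t)"
      using assms(3)[OF traj]
      by (simp add: y_def[abs_def] z_def has_real_derivative_iff_has_vector_derivative)
  qed
  then have "has_distributional_derivative T y z"
    using \<open>T > 0\<close> cont(2)
    by (intro has_distributional_derivative_if_C1) (auto simp: has_real_derivative_iff_has_vector_derivative)
  moreover have "y \<in> borel_measurable (lebesgue_on {0<..<T})" "z \<in> borel_measurable (lebesgue_on {0<..<T})"
    by (auto intro!: continuous_imp_measurable_on_sets_lebesgue continuous_on_subset[OF cont(1)]
        continuous_on_subset[OF cont(2)])
  ultimately have "has_distributional_derivative T f1 f2"
    using L2 f1 f2 unfolding in_L2_def
    by (intro has_distributional_derivative_cong_AE[of f1 T y f2 z]) (auto simp: y_def z_def)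
  then show "has_distributional_derivative T f1 f2 \<and>
      (in_H1 T f1 \<longrightarrow>
        (\<forall>g. in_L2 T g \<and> has_distributional_derivative T f1 g \<longrightarrow>
          (AE t in lebesgue_on {0<..<T}. f2 t = g t)))"
    using L2(2) distributional_derivative_unique by blast
qed

end
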